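(* Let $K$ be a field, $S=K[x_1,\ldots,x_n]$, and let $I\subset S$ be a monomial ideal, minimally generated by $m$ monomials, with $G(I)=\{u_1,\ldots,u_m\}$ its set of minimal monomial generators. Then the following are equivalent: \begin{enumerate} \item[(1)] There exists a linear order $u_1\leqslant u_2\leqslant\cdots\leqslant u_m$ on $G(I)$. \item[(2)] The ideal $I_j=(u_1,u_2,\ldots,u_j)$ has a Stanley decomposition of the form $$I_j=u_1K[Z_1]\oplus u_2K[Z_2]\oplus\cdots\oplus u_jK[Z_j],\text{ for all }1\leq j\leq m.$$ \end{enumerate}
   Context: A monomial ideal $I\subset S$ has linear quotients if there exists a linear order $u_1\leqslant u_2\leqslant\cdots\leqslant u_m$ on $G(I)$, that is, for every $2\leq j\leq m$, the ideal $(u_1,\ldots,u_{j-1}):u_j$ is generated by a subset of the variables $x_1,\ldots,x_n$. A Stanley decomposition of a monomial ideal $J\subset S$ is a finite direct sum of $K$-vector spaces $J=\bigoplus_{i=1}^r v_iK[Z_i]$, where each $v_i\in J$ is homogeneous with respect to the $\mathbb Z^n$-grading, $Z_i\subset\{x_1,\ldots,x_n\}$, and $v_iK[Z_i]$ is a free $K[Z_i]$-module. *)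

theory Defs
  imports Complex_Main "HOL-Library.Poly_Mapping"
begin

text \<open>
  The polynomial ring over \<^typ>\<open>'k\<close> whose variables are indexed by the finite type
  \<^typ>\<open>'n\<close>, so that the number of variables is \<open>CARD('n)\<close>. An exponent vector is a
  finitely supported function \<open>'n \<Rightarrow>\<^sub>0 nat\<close>, and multiplication is convolution.
\<close>

type_synonym ('n, 'k) poly_ring = "('n \<Rightarrow>\<^sub>0 nat) \<Rightarrow>\<^sub>0 'k"

definition monomials :: "('n::finite, 'k::field) poly_ring set" where
  "monomials = range (\<lambda>a. Poly_Mapping.single a 1)"

definition var :: "'n::finite \<Rightarrow> ('n, 'k::field) poly_ring" where
  "var i = Poly_Mapping.single (Poly_Mapping.single i 1) 1"

text \<open>Ideals are the submodules of the ring regarded as a module over itself.\<close>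

definition ideal_gen :: "'a::comm_ring_1 set \<Rightarrow> 'a set" where
  "ideal_gen B = module.span (*) B"

definition colon :: "'a::comm_ring_1 set \<Rightarrow> 'a \<Rightarrow> 'a set" where
  "colon J u = {f. f * u \<in> J}"

definition monomial_ideal :: "('n::finite, 'k::field) poly_ring set \<Rightarrow> bool" where
  "monomial_ideal I \<longleftrightarrow> (\<exists>B \<subseteq> monomials. I = ideal_gen B)"

text \<open>\<open>G\<close> is the (unique) minimal set \<open>G(I)\<close> of monomial generators of \<open>I\<close>.\<close>

definition minimal_monomial_generators ::
  "('n::finite, 'k::field) poly_ring set \<Rightarrow> ('n, 'k) poly_ring set \<Rightarrow> bool" where
  "minimal_monomial_generators I G \<longleftrightarrow>
     G \<subseteq> monomials \<and> ideal_gen G = I \<and> (\<forall>H. H \<subset> G \<longrightarrow> ideal_gen H \<noteq> I)"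

text \<open>The sequence \<open>u 1, \<dots>, u m\<close> is a linear order, i.e. an order giving linear quotients.\<close>

definition linear_order_on_gens :: "nat \<Rightarrow> (nat \<Rightarrow> ('n::finite, 'k::field) poly_ring) \<Rightarrow> bool" where
  "linear_order_on_gens m u \<longleftrightarrow>
     (\<forall>j\<in>{2..m}. \<exists>X \<subseteq> range var. colon (ideal_gen (u ` {1..j - 1})) (u j) = ideal_gen X)"

text \<open>The subalgebra \<open>K[Z]\<close>, a set of variables being given by the set of its indices.\<close>

definition subpoly :: "'n::finite set \<Rightarrow> ('n, 'k::field) poly_ring set" where
  "subpoly Z = {f. \<forall>a\<in>Poly_Mapping.keys f. Poly_Mapping.keys a \<subseteq> Z}"

definition stanley_space ::
  "('n::finite, 'k::field) poly_ring \<Rightarrow> 'n set \<Rightarrow> ('n, 'k) poly_ring set" where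
  "stanley_space v Z = (*) v ` subpoly Z"

text \<open>Homogeneous for the grading by \<open>\<int>\<^sup>n\<close>: at most one exponent vector occurs.\<close>

definition multihomogeneous :: "('n::finite, 'k::field) poly_ring \<Rightarrow> bool" where
  "multihomogeneous v \<longleftrightarrow> (\<exists>a c. v = Poly_Mapping.single a c)"

text \<open>
  Internal direct sum. The summands used below are closed under addition and under
  multiplication by scalars, so this is the direct sum of \<open>K\<close>-vector spaces.
\<close>

definition is_direct_sum :: "'a::ab_group_add set \<Rightarrow> 'i set \<Rightarrow> ('i \<Rightarrow> 'a set) \<Rightarrow> bool" where
  "is_direct_sum J A W \<longleftrightarrow>
     J = {\<Sum>i\<in>A. f i | f. \<forall>i\<in>A. f i \<in> W i} \<and>
     (\<forall>f. (\<forall>i\<in>A. f i \<in> W i) \<and> (\<Sum>i\<in>A. f i) = 0 \<longrightarrow> (\<forall>i\<in>A. f i = 0))"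

text \<open>
  \<open>J = v 1 K[Z 1] \<oplus> \<dots> \<oplus> v r K[Z r]\<close>. The last condition on each summand says that the
  cyclic \<open>K[Z i]\<close>-module \<open>v i K[Z i]\<close> is free with basis \<open>v i\<close>.
\<close>

definition stanley_decomposition ::
  "('n::finite, 'k::field) poly_ring set \<Rightarrow> nat \<Rightarrow> (nat \<Rightarrow> ('n, 'k) poly_ring) \<Rightarrow>
   (nat \<Rightarrow> 'n set) \<Rightarrow> bool" where
  "stanley_decomposition J r v Z \<longleftrightarrow>
     (\<forall>i\<in>{1..r}. v i \<in> J \<and> multihomogeneous (v i) \<and>
        (\<forall>f\<in>subpoly (Z i). v i * f = 0 \<longrightarrow> f = 0)) \<and>
     is_direct_sum J {1..r} (\<lambda>i. stanley_space (v i) (Z i))"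

text \<open>
  The sets \<open>Z i\<close> do not depend on \<open>j\<close>. If they were chosen separately for each \<open>j\<close>, the
  sequence \<open>a\<^sup>2, x\<close> in \<open>K[a, x]\<close> would qualify, since
  \<open>(a\<^sup>2, x) = a\<^sup>2 K[a] \<oplus> x K[a, x]\<close>, although \<open>(a\<^sup>2) : x = (a\<^sup>2)\<close>.
\<close>

definition stanley_filtration :: "nat \<Rightarrow> (nat \<Rightarrow> ('n::finite, 'k::field) poly_ring) \<Rightarrow> bool" where
  "stanley_filtration m u \<longleftrightarrow>
     (\<exists>Z. \<forall>j\<in>{1..m}. stanley_decomposition (ideal_gen (u ` {1..j})) j u Z)"

end

theory Submission
  imports Defs
begin

text \<open>
  Every subspace involved is spanned by monomials, so the theorem is a statement about sets of
  exponent vectors. Let \<open>E j\<close> be the exponents of \<open>(u 1, \<dots>, u j)\<close>. A Stanley filtration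
  with sets \<open>Z j\<close> is the same as the equality of \<open>E j - E (j - 1)\<close> with the exponents of
  \<open>u j K[Z j]\<close>, for all \<open>j\<close>. This equality says that a monomial \<open>w\<close> satisfies
  \<open>w * u j \<in> (u 1, \<dots>, u (j - 1))\<close> if and only if some variable outside \<open>Z j\<close> divides
  \<open>w\<close>, that is, that the colon ideal is generated by the variables outside \<open>Z j\<close>.
\<close>

section \<open>Monomial spans and multiplication by a monomial\<close>

text \<open>Ideals are spans in the ring over itself, so this provides the span lemmas for
  \<open>ideal_gen\<close>.\<close>

interpretation ring_module: module "(*) :: 'a::comm_ring_1 \<Rightarrow> 'a \<Rightarrow> 'a"
  by standard (simp_all add: algebra_simps)

text \<open>Over a field this is the vector space with basis the monomials with exponents in
  \<open>E\<close>. Describing it by supports turns inclusions into statements about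
  \<open>keys\<close>.\<close>

definition monomial_span :: "'a set \<Rightarrow> ('a \<Rightarrow>\<^sub>0 'b::zero) set" where
  "monomial_span E = {f. Poly_Mapping.keys f \<subseteq> E}"

lemma poly_mapping_eq_sum_single:
  fixes f :: "'a \<Rightarrow>\<^sub>0 'b::comm_monoid_add"
  assumes "finite A" "Poly_Mapping.keys f \<subseteq> A"
  shows "f = (\<Sum>k\<in>A. Poly_Mapping.single k (Poly_Mapping.lookup f k))"
  using assms
  by (intro poly_mapping_eqI)
    (auto simp: lookup_sum lookup_single when_def sum.delta in_keys_iff)

lemma single_in_monomial_span:
  "Poly_Mapping.single a (1 :: 'b::zero_neq_one) \<in> monomial_span E \<longleftrightarrow> a \<in> E"
  by (simp add: monomial_span_def)

text \<open>The monomials in the span recover \<open>E\<close>; this allows equalities of ideals to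
  be replaced by equalities of exponent sets.\<close>

lemma monomial_span_eq_iff:
  "(monomial_span E :: ('a \<Rightarrow>\<^sub>0 'b::zero_neq_one) set) = monomial_span F \<longleftrightarrow> E = F"
  by (metis single_in_monomial_span subsetI subset_antisym)

text \<open>Pulling back along the translation by \<open>a\<close> is division by the monomial with
  exponent \<open>a\<close>, which is exact when that monomial divides every term.\<close>

lemma single_mult_map_key:
  fixes f :: "'a::cancel_comm_monoid_add \<Rightarrow>\<^sub>0 'b::comm_semiring_1"
  assumes "Poly_Mapping.keys f \<subseteq> range ((+) a)"
  shows "Poly_Mapping.single a 1 * Poly_Mapping.map_key ((+) a) f = f"
proof -
  let ?g = "Poly_Mapping.map_key ((+) a) f"
  have keys: "Poly_Mapping.keys f = (+) a ` Poly_Mapping.keys ?g"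
    using assms by (auto simp: keys_map_key[OF inj_on_add])
  have "Poly_Mapping.single a 1 * ?g =
      (\<Sum>k\<in>Poly_Mapping.keys ?g. Poly_Mapping.single (a + k) (Poly_Mapping.lookup f (a + k)))"
    by (subst poly_mapping_eq_sum_single[of "Poly_Mapping.keys ?g" ?g])
      (simp_all add: sum_distrib_left mult_single map_key.rep_eq[OF inj_on_add])
  also have "\<dots> = (\<Sum>k\<in>Poly_Mapping.keys f. Poly_Mapping.single k (Poly_Mapping.lookup f k))"
    unfolding keys by (simp add: sum.reindex inj_on_def)
  also have "\<dots> = f"
    by (rule poly_mapping_eq_sum_single[symmetric]) simp_all
  finally show ?thesis .
qed

text \<open>By cancellation, only the term of \<open>f\<close> with exponent \<open>d\<close> is
  moved to \<open>a + d\<close>, so coefficients are shifted and never merged.\<close>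

lemma lookup_single_mult:
  fixes f :: "'a::cancel_comm_monoid_add \<Rightarrow>\<^sub>0 'b::comm_semiring_1"
  shows "Poly_Mapping.lookup (Poly_Mapping.single a 1 * f) (a + d) = Poly_Mapping.lookup f d"
proof -
  have "Poly_Mapping.single a 1 * f =
      (\<Sum>k\<in>Poly_Mapping.keys f. Poly_Mapping.single (a + k) (Poly_Mapping.lookup f k))"
    by (subst poly_mapping_eq_sum_single[of "Poly_Mapping.keys f" f])
      (simp_all add: sum_distrib_left mult_single)
  then show ?thesis
    by (auto simp: lookup_sum lookup_single when_def sum.delta in_keys_iff)
qed

lemma keys_single_mult:
  fixes f :: "'a::cancel_comm_monoid_add \<Rightarrow>\<^sub>0 'b::comm_semiring_1"
  shows "Poly_Mapping.keys (Poly_Mapping.single a 1 * f) = (+) a ` Poly_Mapping.keys f"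
proof
  show "Poly_Mapping.keys (Poly_Mapping.single a 1 * f) \<subseteq> (+) a ` Poly_Mapping.keys f"
    using keys_mult[of "Poly_Mapping.single a 1" f] by auto
  show "(+) a ` Poly_Mapping.keys f \<subseteq> Poly_Mapping.keys (Poly_Mapping.single a 1 * f)"
    by (auto simp: in_keys_iff lookup_single_mult)
qed

text \<open>This supplies the freeness of the summands in a Stanley decomposition by
  monomials.\<close>

lemma single_mult_eq_0_iff:
  fixes f :: "'a::cancel_comm_monoid_add \<Rightarrow>\<^sub>0 'b::comm_semiring_1"
  shows "Poly_Mapping.single a 1 * f = 0 \<longleftrightarrow> f = 0"
  by (metis lookup_single_mult lookup_zero mult_zero_right poly_mapping_eqI)

section \<open>Monomial ideals, colon ideals and Stanley spaces as monomial spans\<close>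

text \<open>The multiples of the generating exponents are stable under adding any exponent, so their
  span is an ideal; conversely, each term of an element of it is a multiple of a generator.\<close>

lemma ideal_gen_monomials:
  "ideal_gen ((\<lambda>a. Poly_Mapping.single a 1) ` A) =
    (monomial_span (\<Union>a\<in>A. range ((+) a)) ::
      ('a::cancel_comm_monoid_add \<Rightarrow>\<^sub>0 'b::comm_ring_1) set)"
    (is "ideal_gen ?B = monomial_span ?E")
proof
  have "ring_module.subspace (monomial_span ?E :: ('a \<Rightarrow>\<^sub>0 'b) set)"
  proof (rule ring_module.subspaceI)
    fix c f :: "'a \<Rightarrow>\<^sub>0 'b"
    assume f: "f \<in> monomial_span ?E"
    show "c * f \<in> monomial_span ?E"
      unfolding monomial_span_def
    proof safe
      fix k
      assume "k \<in> Poly_Mapping.keys (c * f)"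
      then obtain b e where "e \<in> Poly_Mapping.keys f" and k: "k = b + e"
        using keys_mult[of c f] by blast
      then obtain a d where "a \<in> A" "e = a + d"
        using f unfolding monomial_span_def by blast
      then have "a \<in> A" "k = a + (b + d)"
        using k by (simp_all add: add.left_commute)
      then show "k \<in> ?E"
        by blast
    qed
  next
    fix f g :: "'a \<Rightarrow>\<^sub>0 'b"
    assume "f \<in> monomial_span ?E" "g \<in> monomial_span ?E"
    then show "f + g \<in> monomial_span ?E"
      using keys_add[of f g] unfolding monomial_span_def by blast
  qed (simp add: monomial_span_def)
  moreover have "?B \<subseteq> monomial_span ?E"
    \<comment> \<open>A generating exponent is its own multiple: \<open>a = a + 0\<close>.\<close>
    by (force simp: single_in_monomial_span image_iff intro: exI[of _ 0])
  ultimately show "ideal_gen ?B \<subseteq> monomial_span ?E"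
    unfolding ideal_gen_def by (intro ring_module.span_minimal)
next
  show "monomial_span ?E \<subseteq> ideal_gen ?B"
  proof
    fix f :: "'a \<Rightarrow>\<^sub>0 'b"
    assume f: "f \<in> monomial_span ?E"
    have "Poly_Mapping.single k (Poly_Mapping.lookup f k) \<in> ideal_gen ?B"
      if "k \<in> Poly_Mapping.keys f" for k
    proof -
      obtain a d where "a \<in> A" and k: "k = a + d"
        using f \<open>k \<in> Poly_Mapping.keys f\<close> by (auto simp: monomial_span_def)
      then have "Poly_Mapping.single d (Poly_Mapping.lookup f k) * Poly_Mapping.single a 1
          \<in> ideal_gen ?B"
        unfolding ideal_gen_def by (intro ring_module.span_scale ring_module.span_base imageI)
      then show ?thesis
        by (simp add: mult_single k add.commute)
    qed
    then have "(\<Sum>k\<in>Poly_Mapping.keys f. Poly_Mapping.single k (Poly_Mapping.lookup f k))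
        \<in> ideal_gen ?B"
      unfolding ideal_gen_def by (rule ring_module.span_sum)
    then show "f \<in> ideal_gen ?B"
      using poly_mapping_eq_sum_single[of "Poly_Mapping.keys f" f] by simp
  qed
qed

text \<open>Multiplication by a monomial translates the support exactly, so membership in the colon
  can be tested exponent by exponent.\<close>

lemma colon_monomial_span:
  "colon (monomial_span E) (Poly_Mapping.single a 1) =
    (monomial_span {d. a + d \<in> E} :: ('a::cancel_comm_monoid_add \<Rightarrow>\<^sub>0 'b::comm_ring_1) set)"
proof -
  have "Poly_Mapping.keys (f * Poly_Mapping.single a 1) = (+) a ` Poly_Mapping.keys f"
    for f :: "'a \<Rightarrow>\<^sub>0 'b"
    using keys_single_mult[of a f] by (simp add: mult.commute)
  then show ?thesis
    by (auto simp: colon_def monomial_span_def)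
qed

lemma stanley_space_monomial:
  "stanley_space (Poly_Mapping.single a 1) Z =
    (monomial_span ((+) a ` {d. Poly_Mapping.keys d \<subseteq> Z}) :: ('n::finite, 'k::field) poly_ring set)"
proof (intro equalityI subsetI)
  fix f :: "('n, 'k) poly_ring"
  assume "f \<in> stanley_space (Poly_Mapping.single a 1) Z"
  then show "f \<in> monomial_span ((+) a ` {d. Poly_Mapping.keys d \<subseteq> Z})"
    by (auto simp: stanley_space_def subpoly_def monomial_span_def keys_single_mult)
next
  fix f :: "('n, 'k) poly_ring"
  assume f: "f \<in> monomial_span ((+) a ` {d. Poly_Mapping.keys d \<subseteq> Z})"
  then have "Poly_Mapping.single a 1 * Poly_Mapping.map_key ((+) a) f = f"
    by (intro single_mult_map_key) (auto simp: monomial_span_def)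
  moreover have "Poly_Mapping.map_key ((+) a) f \<in> subpoly Z"
    using f by (force simp: subpoly_def monomial_span_def keys_map_key[OF inj_on_add])
  ultimately show "f \<in> stanley_space (Poly_Mapping.single a 1) Z"
    unfolding stanley_space_def by (metis imageI)
qed

section \<open>Direct sums of monomial spans\<close>

text \<open>Distinct monomials are linearly independent, so spans of monomials can only meet
  nontrivially through a common exponent.\<close>

lemma is_direct_sum_monomial_span:
  assumes "finite A"
  shows "is_direct_sum (monomial_span E :: ('a \<Rightarrow>\<^sub>0 'b::{ab_group_add,zero_neq_one}) set) A
      (\<lambda>i. monomial_span (C i)) \<longleftrightarrow>
    E = (\<Union>i\<in>A. C i) \<and> (\<forall>i\<in>A. \<forall>j\<in>A. i \<noteq> j \<longrightarrow> C i \<inter> C j = {})"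
    (is "?L \<longleftrightarrow> ?R")
proof
  assume ?L
  then have span: "monomial_span E =
        {\<Sum>i\<in>A. f i | f. \<forall>i\<in>A. f i \<in> (monomial_span (C i) :: ('a \<Rightarrow>\<^sub>0 'b) set)}"
    and indep: "\<And>f :: _ \<Rightarrow> ('a \<Rightarrow>\<^sub>0 'b). \<lbrakk>\<forall>i\<in>A. f i \<in> monomial_span (C i); (\<Sum>i\<in>A. f i) = 0\<rbrakk>
        \<Longrightarrow> \<forall>i\<in>A. f i = 0"
    unfolding is_direct_sum_def by blast+
  show ?R
  proof (intro conjI ballI impI)
    show "E = (\<Union>i\<in>A. C i)"
    proof
      show "E \<subseteq> (\<Union>i\<in>A. C i)"
      proof
        fix e
        assume "e \<in> E"
        then have "Poly_Mapping.single e (1 :: 'b) \<in> monomial_span E"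
          by (simp add: single_in_monomial_span)
        then obtain f :: "_ \<Rightarrow> ('a \<Rightarrow>\<^sub>0 'b)" where f: "\<forall>i\<in>A. f i \<in> monomial_span (C i)"
          and e: "Poly_Mapping.single e 1 = (\<Sum>i\<in>A. f i)"
          unfolding span by blast
        \<comment> \<open>Comparing coefficients at \<open>e\<close> forces some summand to have
          \<open>e\<close> in its support.\<close>
        have "(\<Sum>i\<in>A. Poly_Mapping.lookup (f i) e) = 1"
          by (metis e lookup_single_eq lookup_sum)
        then obtain i where "i \<in> A" "Poly_Mapping.lookup (f i) e \<noteq> 0"
          using sum.not_neutral_contains_not_neutral[of "\<lambda>i. Poly_Mapping.lookup (f i) e" A]
          by auto
        then show "e \<in> (\<Union>i\<in>A. C i)"
          using f by (auto simp: monomial_span_def simp flip: in_keys_iff)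
      qed
      show "(\<Union>i\<in>A. C i) \<subseteq> E"
      proof
        fix e
        assume "e \<in> (\<Union>i\<in>A. C i)"
        then obtain i where i: "i \<in> A" "e \<in> C i"
          by blast
        let ?f = "\<lambda>j. if j = i then Poly_Mapping.single e (1 :: 'b) else 0"
        have "\<forall>j\<in>A. ?f j \<in> monomial_span (C j)"
          using i by (simp add: monomial_span_def)
        moreover have "(\<Sum>j\<in>A. ?f j) = Poly_Mapping.single e 1"
          using i assms by (simp add:)
        ultimately have "Poly_Mapping.single e (1 :: 'b) \<in> monomial_span E"
          unfolding span mem_Collect_eq by (intro exI[of _ ?f]) simp
        then show "e \<in> E"
          by (simp add: single_in_monomial_span)
      qed
    qed
  next
    fix i j
    assume ij: "i \<in> A" "j \<in> A" "i \<noteq> j"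
    show "C i \<inter> C j = {}"
    proof (rule ccontr)
      assume "C i \<inter> C j \<noteq> {}"
      then obtain e where e: "e \<in> C i" "e \<in> C j"
        by blast
      let ?s = "Poly_Mapping.single e (1 :: 'b)"
      \<comment> \<open>A shared exponent \<open>e\<close> gives a nontrivial relation: the monomial
        in component \<open>i\<close>, its negative in component \<open>j\<close>.\<close>
      let ?f = "\<lambda>k. (if k = i then ?s else 0) - (if k = j then ?s else 0)"
      have "\<forall>k\<in>A. ?f k \<in> monomial_span (C k)"
        using e ij by (auto simp: monomial_span_def in_keys_iff lookup_minus lookup_single when_def
            split: if_splits)
      moreover have "(\<Sum>k\<in>A. ?f k) = 0"
        using ij assms by (simp add: sum_subtractf)
      ultimately have "?f i = 0"
        using indep[of ?f] ij by blast
      then have "?s = 0"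
        using ij by simp
      then show False
        by (metis lookup_single_eq lookup_zero zero_neq_one)
    qed
  qed
next
  assume ?R
  then have E: "E = (\<Union>i\<in>A. C i)" and disj: "\<forall>i\<in>A. \<forall>j\<in>A. i \<noteq> j \<longrightarrow> C i \<inter> C j = {}"
    by auto
  show ?L
    unfolding is_direct_sum_def
  proof (intro conjI allI impI)
    show "monomial_span E =
        {\<Sum>i\<in>A. f i | f. \<forall>i\<in>A. f i \<in> (monomial_span (C i) :: ('a \<Rightarrow>\<^sub>0 'b) set)}"
    proof (intro equalityI subsetI)
      fix f :: "'a \<Rightarrow>\<^sub>0 'b"
      assume f: "f \<in> monomial_span E"
      \<comment> \<open>The terms of \<open>f\<close> are sorted by the \<open>C i\<close>
        containing their exponent; disjointness ensures that each is counted once.\<close>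
      let ?K = "\<lambda>i. Poly_Mapping.keys f \<inter> C i"
      let ?s = "\<lambda>k. Poly_Mapping.single k (Poly_Mapping.lookup f k)"
      have "Poly_Mapping.keys f = (\<Union>i\<in>A. ?K i)"
        using f E by (auto simp: monomial_span_def)
      then have "f = sum ?s (\<Union>i\<in>A. ?K i)"
        by (metis finite_keys order_refl poly_mapping_eq_sum_single)
      also have "\<dots> = (\<Sum>i\<in>A. sum ?s (?K i))"
        using assms disj by (intro sum.UNION_disjoint) auto
      finally have "f = (\<Sum>i\<in>A. sum ?s (?K i))" .
      moreover have "\<forall>i\<in>A. sum ?s (?K i) \<in> monomial_span (C i)"
        by (auto simp: monomial_span_def in_keys_iff lookup_sum lookup_single when_def
            split: if_splits)
      ultimately show "f \<in> {\<Sum>i\<in>A. f i | f. \<forall>i\<in>A. f i \<in> monomial_span (C i)}"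
        by blast
    next
      fix f :: "'a \<Rightarrow>\<^sub>0 'b"
      assume "f \<in> {\<Sum>i\<in>A. f i | f. \<forall>i\<in>A. f i \<in> monomial_span (C i)}"
      then obtain g where f: "f = (\<Sum>i\<in>A. g i)" and g: "\<forall>i\<in>A. g i \<in> monomial_span (C i)"
        by blast
      show "f \<in> monomial_span E"
        unfolding monomial_span_def
      proof safe
        fix e
        assume "e \<in> Poly_Mapping.keys f"
        then have "(\<Sum>i\<in>A. Poly_Mapping.lookup (g i) e) \<noteq> 0"
          by (simp add: f in_keys_iff lookup_sum)
        then obtain i where "i \<in> A" "Poly_Mapping.lookup (g i) e \<noteq> 0"
          by (rule sum.not_neutral_contains_not_neutral)
        then show "e \<in> E"
          using g E by (auto simp: monomial_span_def simp flip: in_keys_iff)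
      qed
    qed
  next
    fix f :: "_ \<Rightarrow> ('a \<Rightarrow>\<^sub>0 'b)"
    assume f: "(\<forall>i\<in>A. f i \<in> monomial_span (C i)) \<and> (\<Sum>i\<in>A. f i) = 0"
    show "\<forall>i\<in>A. f i = 0"
    proof (intro ballI poly_mapping_eqI, rule ccontr)
      fix i e
      assume i: "i \<in> A" and ne: "Poly_Mapping.lookup (f i) e \<noteq> Poly_Mapping.lookup 0 e"
      then have "e \<in> C i"
        using f by (auto simp: monomial_span_def simp flip: in_keys_iff)
      \<comment> \<open>By disjointness no other summand involves \<open>e\<close>, so the
        coefficient of the whole sum at \<open>e\<close> is that of \<open>f i\<close>.\<close>
      then have "\<forall>j\<in>A - {i}. Poly_Mapping.lookup (f j) e = 0"
        using f disj i unfolding monomial_span_def not_in_keys_iff_lookup_eq_zero[symmetric]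
        by blast
      then have "(\<Sum>j\<in>A. Poly_Mapping.lookup (f j) e) = Poly_Mapping.lookup (f i) e"
        using assms i by (simp add: sum.remove)
      moreover have "(\<Sum>j\<in>A. Poly_Mapping.lookup (f j) e) = 0"
        by (metis f lookup_sum lookup_zero)
      ultimately show False
        using ne by simp
    qed
  qed
qed

section \<open>Ideals generated by variables\<close>

lemma ideal_gen_vars:
  "ideal_gen (var ` Y) =
    (monomial_span {d. Poly_Mapping.keys d \<inter> Y \<noteq> {}} :: ('n::finite, 'k::field) poly_ring set)"
proof -
  have "var ` Y = (\<lambda>a. Poly_Mapping.single a (1 :: 'k)) ` (\<lambda>i. Poly_Mapping.single i 1) ` Y"
    by (simp add: var_def image_image)
  moreover have "(\<Union>i\<in>Y. range ((+) (Poly_Mapping.single i (1 :: nat)))) =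
      {d. Poly_Mapping.keys d \<inter> Y \<noteq> {}}"
  proof (intro equalityI subsetI)
    fix d :: "'n \<Rightarrow>\<^sub>0 nat"
    assume "d \<in> {d. Poly_Mapping.keys d \<inter> Y \<noteq> {}}"
    then obtain i where i: "i \<in> Y" "i \<in> Poly_Mapping.keys d"
      by blast
    \<comment> \<open>The truncated subtraction is exact because the variable \<open>i\<close>
      occurs in \<open>d\<close>.\<close>
    have "d = Poly_Mapping.single i 1 + (d - Poly_Mapping.single i 1)"
      using i(2)
      by (intro poly_mapping_eqI) (auto simp: lookup_add lookup_minus lookup_single when_def in_keys_iff)
    then show "d \<in> (\<Union>i\<in>Y. range ((+) (Poly_Mapping.single i 1)))"
      using i(1) by blast
  next
    fix d
    assume "d \<in> (\<Union>i\<in>Y. range ((+) (Poly_Mapping.single i (1 :: nat))))"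
    then obtain i where i: "i \<in> Y" "i \<in> Poly_Mapping.keys d"
      by (auto simp: in_keys_iff lookup_add)
    then show "d \<in> {d. Poly_Mapping.keys d \<inter> Y \<noteq> {}}"
      by blast
  qed
  ultimately show ?thesis
    by (simp add: ideal_gen_monomials)
qed

section \<open>Filtrations of sets and their layers\<close>

text \<open>Comparing the decompositions of \<open>E j\<close> and \<open>E (j - 1)\<close>, which
  use the same pieces, isolates \<open>C j\<close> as the new layer. Conversely, the layers of an
  increasing chain from the empty set are disjoint and fill each stage.\<close>

lemma disjoint_filtration_iff:
  fixes C E :: "nat \<Rightarrow> 'a set"
  assumes "E 0 = {}" and mono: "\<And>i j. i \<le> j \<Longrightarrow> E i \<subseteq> E j"
  shows "(\<forall>j\<in>{1..m}. E j = (\<Union>i\<in>{1..j}. C i) \<and>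
      (\<forall>i\<in>{1..j}. \<forall>k\<in>{1..j}. i \<noteq> k \<longrightarrow> C i \<inter> C k = {})) \<longleftrightarrow>
    (\<forall>j\<in>{1..m}. C j = E j - E (j - 1))"
    (is "?L \<longleftrightarrow> ?R")
proof
  assume L: ?L
  show ?R
  proof
    fix j
    assume j: "j \<in> {1..m}"
    have "{1..j} = insert j {1..j - 1}"
      using j by auto
    moreover have "E (j - 1) = (\<Union>i\<in>{1..j - 1}. C i)"
    \<comment> \<open>The assumption starts at index 1, so the union for \<open>j - 1 = 0\<close>
      comes from \<open>E 0 = {}\<close>.\<close>
    proof (cases "j = 1")
      case False
      then have "j - 1 \<in> {1..m}"
        using j by auto
      then show ?thesis
        using L by blast
    qed (simp add: assms(1))
    ultimately have "E j = C j \<union> E (j - 1)"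
      using L j by auto
    moreover have "C j \<inter> C i = {}" if "i \<in> {1..j - 1}" for i
    proof -
      have "i \<in> {1..j}" "j \<in> {1..j}" "j \<noteq> i"
        using that j by auto
      then show ?thesis
        using L j by blast
    qed
    then have "C j \<inter> E (j - 1) = {}"
      unfolding \<open>E (j - 1) = _\<close> by blast
    ultimately show "C j = E j - E (j - 1)"
      by blast
  qed
next
  assume R: ?R
  have un: "E j = (\<Union>i\<in>{1..j}. C i)" if "j \<le> m" for j
    using that
  proof (induction j)
    case (Suc j)
    have "{1..Suc j} = insert (Suc j) {1..j}"
      by auto
    moreover have "E (Suc j) = C (Suc j) \<union> E j"
      using R Suc.prems mono[of j "Suc j"] by auto
    ultimately show ?case
      using Suc by auto
  qed (simp add: assms(1))
  have lt: "C i \<inter> C k = {}" if "i \<in> {1..m}" "k \<in> {1..m}" "i < k" for i k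
  proof -
    have "C i \<subseteq> E i" "C k = E k - E (k - 1)"
      using R that by auto
    \<comment> \<open>The earlier layer lies inside \<open>E (k - 1)\<close>, which is exactly what
      the layer \<open>C k\<close> omits.\<close>
    moreover have "E i \<subseteq> E (k - 1)"
      using that by (intro mono) auto
    ultimately show ?thesis
      by blast
  qed
  show ?L
  proof (intro ballI conjI impI)
    fix j i k
    assume "j \<in> {1..m}" "i \<in> {1..j}" "k \<in> {1..j}" "i \<noteq> k"
    then show "C i \<inter> C k = {}"
      using lt[of i k] lt[of k i] by (cases "i < k") auto
  qed (use un in auto)
qed

section \<open>Translation of both conditions into exponents\<close>

lemma linear_order_on_gens_iff_stanley_filtration:
  fixes u :: "nat \<Rightarrow> ('n::finite, 'k::field) poly_ring"
  assumes "u ` {1..m} \<subseteq> monomials"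
  shows "linear_order_on_gens m u \<longleftrightarrow> stanley_filtration m u"
proof -
  have "\<forall>i\<in>{1..m}. \<exists>a. u i = Poly_Mapping.single a 1"
    using assms by (auto simp: monomials_def)
  then obtain a where a: "\<And>i. i \<in> {1..m} \<Longrightarrow> u i = Poly_Mapping.single (a i) 1"
    by metis
  define E where "E j = (\<Union>i\<in>{1..j}. range ((+) (a i)))" for j :: nat
  define C where "C Z i = (+) (a i) ` {d. Poly_Mapping.keys d \<subseteq> Z i}" for Z :: "nat \<Rightarrow> 'n set" and i
  \<comment> \<open>The case \<open>j = 0\<close> is included: it is the zero ideal, with
    \<open>E 0\<close> empty.\<close>
  have ideal: "ideal_gen (u ` {1..j}) = monomial_span (E j)" if "j \<le> m" for j
  proof -
    have "u ` {1..j} = (\<lambda>b. Poly_Mapping.single b 1) ` a ` {1..j}"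
      unfolding image_image using a that by (intro image_cong) auto
    then show ?thesis
      by (simp add: ideal_gen_monomials E_def)
  qed
  have E_step: "E j = range ((+) (a j)) \<union> E (j - 1)" if "j \<in> {1..m}" for j
  proof -
    have "{1..j} = insert j {1..j - 1}"
      using that by auto
    then show ?thesis
      by (simp add: E_def)
  qed
  have "linear_order_on_gens m u \<longleftrightarrow>
      (\<forall>j\<in>{2..m}. \<exists>Y. {d. a j + d \<in> E (j - 1)} = {d. Poly_Mapping.keys d \<inter> Y \<noteq> {}})"
  proof -
    have "(\<exists>X \<subseteq> range var. colon (ideal_gen (u ` {1..j - 1})) (u j) = ideal_gen X) \<longleftrightarrow>
        (\<exists>Y. {d. a j + d \<in> E (j - 1)} = {d. Poly_Mapping.keys d \<inter> Y \<noteq> {}})" (is "?P \<longleftrightarrow> _")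
      if "j \<in> {2..m}" for j
    proof -
      have "u j = Poly_Mapping.single (a j) 1" "j - 1 \<le> m"
        using that a[of j] by auto
      then have colon: "colon (ideal_gen (u ` {1..j - 1})) (u j) =
          monomial_span {d. a j + d \<in> E (j - 1)}"
        by (simp only: ideal colon_monomial_span)
      \<comment> \<open>A set of variables is the image under \<open>var\<close> of a set of
        indices.\<close>
      have "?P \<longleftrightarrow> (\<exists>Y. colon (ideal_gen (u ` {1..j - 1})) (u j) = ideal_gen (var ` Y))"
        by (auto simp: subset_image_iff)
      then show ?thesis
        unfolding colon ideal_gen_vars monomial_span_eq_iff .
    qed
    then show ?thesis
      by (simp add: linear_order_on_gens_def)
  qed
  \<comment> \<open>Here \<open>W\<close> is the complement of \<open>Y\<close>. The range now
    starts at 1; the new condition is met by \<open>W = UNIV\<close>, since \<open>E 0\<close> is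
    empty.\<close>
  also have "\<dots> \<longleftrightarrow> (\<forall>j\<in>{1..m}. \<exists>W. \<forall>d. Poly_Mapping.keys d \<subseteq> W \<longleftrightarrow> a j + d \<notin> E (j - 1))"
    (is "?P \<longleftrightarrow> ?Q")
  proof
    assume P: ?P
    show ?Q
    proof
      fix j
      assume j: "j \<in> {1..m}"
      show "\<exists>W. \<forall>d. Poly_Mapping.keys d \<subseteq> W \<longleftrightarrow> a j + d \<notin> E (j - 1)"
      proof (cases "j = 1")
        case True
        then show ?thesis
          by (intro exI[of _ UNIV]) (simp add: E_def)
      next
        case False
        then obtain Y where "{d. a j + d \<in> E (j - 1)} = {d. Poly_Mapping.keys d \<inter> Y \<noteq> {}}"
          using P j by force
        then show ?thesis
          by (intro exI[of _ "- Y"]) blast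
      qed
    qed
  next
    assume Q: ?Q
    show ?P
    proof
      fix j
      assume "j \<in> {2..m}"
      then obtain W where "\<forall>d. Poly_Mapping.keys d \<subseteq> W \<longleftrightarrow> a j + d \<notin> E (j - 1)"
        using Q by force
      then show "\<exists>Y. {d. a j + d \<in> E (j - 1)} = {d. Poly_Mapping.keys d \<inter> Y \<noteq> {}}"
        by (intro exI[of _ "- W"]) blast
    qed
  qed
  \<comment> \<open>Each \<open>W\<close> depends only on its own index, so one family
    \<open>Z\<close> can serve all initial segments.\<close>
  also have "\<dots> \<longleftrightarrow> (\<exists>Z. \<forall>j\<in>{1..m}. \<forall>d. Poly_Mapping.keys d \<subseteq> Z j \<longleftrightarrow> a j + d \<notin> E (j - 1))"
    by (rule bchoice_iff)
  also have "\<dots> \<longleftrightarrow> (\<exists>Z. \<forall>j\<in>{1..m}. C Z j = E j - E (j - 1))"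
  proof -
    have "C Z j = E j - E (j - 1) \<longleftrightarrow>
        (\<forall>d. Poly_Mapping.keys d \<subseteq> Z j \<longleftrightarrow> a j + d \<notin> E (j - 1))" if "j \<in> {1..m}" for Z j
    proof -
      \<comment> \<open>Everything new at stage \<open>j\<close> is a multiple of
        \<open>u j\<close>, so both sides are translates by \<open>a j\<close> and injectivity
        cancels the translation.\<close>
      have "E j - E (j - 1) = (+) (a j) ` {d. a j + d \<notin> E (j - 1)}"
        unfolding E_step[OF that] by blast
      then have "C Z j = E j - E (j - 1) \<longleftrightarrow>
          {d. Poly_Mapping.keys d \<subseteq> Z j} = {d. a j + d \<notin> E (j - 1)}"
        unfolding C_def by (simp only: inj_image_eq_iff[OF inj_on_add])
      then show ?thesis
        by (simp only: set_eq_iff mem_Collect_eq)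
    qed
    then show ?thesis
      by (metis (no_types, lifting))
  qed
  also have "\<dots> \<longleftrightarrow> (\<exists>Z. \<forall>j\<in>{1..m}. E j = (\<Union>i\<in>{1..j}. C Z i) \<and>
      (\<forall>i\<in>{1..j}. \<forall>k\<in>{1..j}. i \<noteq> k \<longrightarrow> C Z i \<inter> C Z k = {}))"
  proof -
    have "E 0 = {}" "\<And>i j. i \<le> j \<Longrightarrow> E i \<subseteq> E j"
      unfolding E_def by (simp, intro UN_mono) auto
    then show ?thesis
      by (simp only: disjoint_filtration_iff)
  qed
  also have "\<dots> \<longleftrightarrow> stanley_filtration m u"
  proof -
    have "stanley_decomposition (ideal_gen (u ` {1..j})) j u Z \<longleftrightarrow> E j = (\<Union>i\<in>{1..j}. C Z i) \<and>
        (\<forall>i\<in>{1..j}. \<forall>k\<in>{1..j}. i \<noteq> k \<longrightarrow> C Z i \<inter> C Z k = {})" if "j \<in> {1..m}" for j Z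
    proof -
      have "u i \<in> ideal_gen (u ` {1..j})" if "i \<in> {1..j}" for i
        unfolding ideal_gen_def using that by (intro ring_module.span_base imageI)
      moreover have ui: "u i = Poly_Mapping.single (a i) 1" if "i \<in> {1..j}" for i
        using that \<open>j \<in> {1..m}\<close> by (intro a) auto
      \<comment> \<open>The conditions on individual summands hold for monomials, which leaves the
        direct sum.\<close>
      then have "multihomogeneous (u i)" "u i * f = 0 \<longrightarrow> f = 0" if "i \<in> {1..j}" for i f
        using that by (auto simp: multihomogeneous_def single_mult_eq_0_iff)
      moreover have "stanley_space (u i) (Z i) = monomial_span (C Z i)" if "i \<in> {1..j}" for i
        using that ui by (simp add: C_def stanley_space_monomial)
      then have "is_direct_sum J {1..j} (\<lambda>i. stanley_space (u i) (Z i)) \<longleftrightarrow>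
          is_direct_sum J {1..j} (\<lambda>i. monomial_span (C Z i))" for J
        by (simp add: is_direct_sum_def)
      moreover have "ideal_gen (u ` {1..j}) = monomial_span (E j)"
        using that ideal by simp
      ultimately show ?thesis
        by (simp add: stanley_decomposition_def is_direct_sum_monomial_span)
    qed
    then show ?thesis
      by (simp add: stanley_filtration_def)
  qed
  finally show ?thesis .
qed

theorem theorem4p1:
  fixes I G :: "('n::finite, 'k::field) poly_ring set" and m :: nat
  assumes "monomial_ideal I"
    and "minimal_monomial_generators I G"
    and "finite G" and "card G = m"
  shows "(\<forall>u. bij_betw u {1..m} G \<longrightarrow> (linear_order_on_gens m u \<longleftrightarrow> stanley_filtration m u)) \<and>
    ((\<exists>u. bij_betw u {1..m} G \<and> linear_order_on_gens m u) \<longleftrightarrow>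
     (\<exists>u. bij_betw u {1..m} G \<and> stanley_filtration m u))"
proof -
  \<comment> \<open>An enumeration of \<open>G\<close> consists of monomials. The equivalence for
    each fixed enumeration also gives the one between the existential statements.\<close>
  have "linear_order_on_gens m u \<longleftrightarrow> stanley_filtration m u" if "bij_betw u {1..m} G" for u
    using that assms(2) linear_order_on_gens_iff_stanley_filtration[of u m]
    by (simp add: bij_betw_def minimal_monomial_generators_def)
  then show ?thesis
    by blast
qed

end
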